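(* Let $n,k$ be positive integers. A naturally ordered groupoid $(Q,\cdot)$ of order $n$, $Q=\{1,\ldots,n\}$, is idempotent and $k$-translatable if and only if there are $a,b\in\mathbb{Z}_n$ such that $x\cdot y=[ax+by]_n$ for all $x,y\in Q$ and (1) $[a+b]_n=1$ and $[a+bk]_n=0$, or, equivalently (for an operation of the form $x\cdot y=[ax+by]_n$), (2) $1\cdot 1=1$ and $1\cdot k=n$.
   Context: For an integer $m$, $[m]_n$ is the element of $\{1,\ldots,n\}$ congruent to $m$ modulo $n$, with the convention $0=n$; an equation $[u]_n=v$ with $v$ an integer means $u\equiv v\pmod n$. In $1\cdot k$, $k$ is understood as the element $[k]_n$ of $Q$. A groupoid is a set with a binary operation; it is idempotent if $x\cdot x=x$ for all $x$. A groupoid on $Q=\{1,\ldots,n\}$ with the natural ordering $1,2,\ldots,n$ is $k$-translatable if $i\cdot j=[i+1]_n\cdot[j+k]_n$ for all $i,j\in Q$. *)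

theory Defs
  imports "HOL-Number_Theory.Cong"
begin

text \<open>
  The representative of \<open>m\<close> modulo \<open>n\<close> in \<open>{1..n}\<close> (so multiples of \<open>n\<close> are sent to \<open>n\<close>, not to
  \<open>0\<close>); only meaningful for \<open>n > 0\<close>.
\<close>
definition rep :: "int \<Rightarrow> int \<Rightarrow> int" where
  "rep n m = (if n dvd m then n else m mod n)"

lemma rep_in: "n > 0 \<Longrightarrow> rep n m \<in> {1..n}"
  by (smt (verit) rep_def dvd_eq_mod_eq_0 pos_mod_sign pos_mod_bound atLeastAtMost_iff)

lemma rep_cong: "[rep n m = m] (mod n)"
  by (auto simp: rep_def cong_def dvd_eq_mod_eq_0)

definition groupoid_on :: "'a set \<Rightarrow> ('a \<Rightarrow> 'a \<Rightarrow> 'a) \<Rightarrow> bool" where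
  "groupoid_on Q f \<longleftrightarrow> (\<forall>x\<in>Q. \<forall>y\<in>Q. f x y \<in> Q)"

definition idempotent_on :: "'a set \<Rightarrow> ('a \<Rightarrow> 'a \<Rightarrow> 'a) \<Rightarrow> bool" where
  "idempotent_on Q f \<longleftrightarrow> (\<forall>x\<in>Q. f x x = x)"

text \<open>Translatability with respect to the natural ordering \<open>1, 2, \<dots>, n\<close> of \<open>{1..n}\<close>.\<close>
definition translatable :: "int \<Rightarrow> int \<Rightarrow> (int \<Rightarrow> int \<Rightarrow> int) \<Rightarrow> bool" where
  "translatable n k f \<longleftrightarrow>
     (\<forall>i\<in>{1..n}. \<forall>j\<in>{1..n}. f i j = f (rep n (i + 1)) (rep n (j + k)))"

definition linear_op :: "int \<Rightarrow> int \<Rightarrow> int \<Rightarrow> (int \<Rightarrow> int \<Rightarrow> int) \<Rightarrow> bool" where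
  "linear_op n a b f \<longleftrightarrow> (\<forall>x\<in>{1..n}. \<forall>y\<in>{1..n}. f x y = rep n (a * x + b * y))"

end

theory Submission
  imports Defs
begin

text \<open>
  Translatability says that the product of \<open>x\<close> and \<open>y\<close> depends only on \<open>y - k x\<close> modulo \<open>n\<close>, say
  through a function \<open>g\<close>. Idempotency then reads \<open>g ((1 - k) x) = x\<close>, so multiplication by
  \<open>1 - k\<close> is injective modulo \<open>n\<close>, hence has an inverse \<open>c\<close>, and \<open>g u = c u\<close>. This gives
  \<open>a = - k c\<close> and \<open>b = c\<close>.
\<close>

lemma rep_eq_iff:
  assumes "n > 0"
  shows "rep n x = rep n y \<longleftrightarrow> [x = y] (mod n)"
proof
  assume "rep n x = rep n y"
  then show "[x = y] (mod n)"
    by (metis rep_cong cong_sym cong_trans)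
next
  assume "[x = y] (mod n)"
  then show "rep n x = rep n y"
    by (metis rep_def cong_def dvd_eq_mod_eq_0)
qed

lemma rep_id: "x \<in> {1..n} \<Longrightarrow> rep n x = x"
  by (cases "x = n") (auto simp: rep_def zdvd_not_zless)

lemma rep_eq_iff_cong:
  assumes "n > 0" and "v \<in> {1..n}"
  shows "rep n x = v \<longleftrightarrow> [x = v] (mod n)"
  using rep_eq_iff[OF assms(1), of x v] rep_id[OF assms(2)] by simp

text \<open>The two products are the representatives of \<open>a + b\<close> and
  \<open>a + b * k\<close>, and in {1..n} the class of 0 is represented by \<open>n\<close>.\<close>

lemma linear_op_normal_form_iff:
  assumes n: "n > 0" and lin: "linear_op n a b f"
  shows "[a + b = 1] (mod n) \<and> [a + b * k = 0] (mod n)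
    \<longleftrightarrow> f 1 1 = 1 \<and> f 1 (rep n k) = n"
proof -
  have one: "1 \<in> {1..n}" and top: "n \<in> {1..n}"
    using n by auto
  have "f 1 1 = rep n (a + b)"
    using lin one by (simp add: linear_op_def)
  moreover have "f 1 (rep n k) = rep n (a + b * rep n k)"
    using lin one rep_in[OF n, of k] by (simp add: linear_op_def)
  moreover have "rep n (a + b * rep n k) = rep n (a + b * k)"
    using n by (simp add: rep_eq_iff cong_add cong_mult rep_cong)
  moreover have "[a + b * k = n] (mod n) \<longleftrightarrow> [a + b * k = 0] (mod n)"
    by (simp add: cong_def)
  ultimately show ?thesis
    using rep_eq_iff_cong[OF n one, of "a + b"] rep_eq_iff_cong[OF n top, of "a + b * k"]
    by simp
qed

lemma linear_op_idempotent:
  assumes n: "n > 0" and lin: "linear_op n a b f" and ab: "[a + b = 1] (mod n)"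
  shows "idempotent_on {1..n} f"
  unfolding idempotent_on_def
proof
  fix x assume x: "x \<in> {1..n}"
  have "[(a + b) * x = 1 * x] (mod n)"
    by (intro cong_mult ab cong_refl)
  then have "[a * x + b * x = x] (mod n)"
    by (simp add: algebra_simps)
  with n x have "rep n (a * x + b * x) = x"
    by (simp add: rep_eq_iff_cong)
  with lin x show "f x x = x"
    by (simp add: linear_op_def)
qed

text \<open>Raising the arguments by 1 and \<open>k\<close> changes \<open>a * i + b * j\<close> by
  \<open>a + b * k\<close>, which vanishes modulo \<open>n\<close>.\<close>

lemma linear_op_translatable:
  assumes n: "n > 0" and lin: "linear_op n a b f" and ab: "[a + b * k = 0] (mod n)"
  shows "translatable n k f"
  unfolding translatable_def
proof (intro ballI)
  fix i j assume i: "i \<in> {1..n}" and j: "j \<in> {1..n}"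
  have "[a * rep n (i + 1) + b * rep n (j + k) = a * (i + 1) + b * (j + k)] (mod n)"
    by (intro cong_add cong_mult cong_refl rep_cong)
  also have "a * (i + 1) + b * (j + k) = (a * i + b * j) + (a + b * k)"
    by (simp add: algebra_simps)
  also have "[(a * i + b * j) + (a + b * k) = (a * i + b * j) + 0] (mod n)"
    by (intro cong_add ab cong_refl)
  finally have "rep n (a * i + b * j) = rep n (a * rep n (i + 1) + b * rep n (j + k))"
    using n by (simp add: rep_eq_iff cong_sym)
  with lin i j show "f i j = f (rep n (i + 1)) (rep n (j + k))"
    using rep_in[OF n] by (simp add: linear_op_def)
qed

text \<open>Iterates the defining shift \<open>t\<close> times. Keeping \<open>x\<close> and
  \<open>y\<close> as unreduced integers under \<open>rep\<close> avoids a case distinction where an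
  index wraps around from \<open>n\<close> to 1.\<close>

lemma translatable_rep_shift:
  assumes n: "n > 0" and tr: "translatable n k f"
  shows "f (rep n x) (rep n y) = f (rep n (x + int t)) (rep n (y + k * int t))"
proof (induction t)
  case 0
  show ?case by simp
next
  case (Suc t)
  let ?u = "x + int t" and ?v = "y + k * int t"
  have "f (rep n ?u) (rep n ?v) = f (rep n (rep n ?u + 1)) (rep n (rep n ?v + k))"
    using tr rep_in[OF n] unfolding translatable_def by blast
  also have "rep n (rep n ?u + 1) = rep n (?u + 1)"
    using n by (simp add: rep_eq_iff cong_add rep_cong)
  also have "rep n (rep n ?v + k) = rep n (?v + k)"
    using n by (simp add: rep_eq_iff cong_add rep_cong)
  also have "?u + 1 = x + int (Suc t)"
    by simp
  also have "?v + k = y + k * int (Suc t)"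
    by (simp add: algebra_simps)
  finally show ?case
    using Suc.IH by simp
qed

lemma translatable_eq_diff:
  assumes n: "n > 0" and tr: "translatable n k f" and x: "x \<ge> 0"
  shows "f (rep n x) (rep n y) = f (rep n 0) (rep n (y - k * x))"
  \<comment> \<open>The shift is applied \<open>x\<close> times starting from
    \<open>(0, y - k * x)\<close>; the number of shifts is a natural number, whence the assumption
    \<open>x \<ge> 0\<close>.\<close>
  using translatable_rep_shift[OF n tr, of 0 "y - k * x" "nat x"] x by simp

lemma idempotent_translatable_linear:
  assumes n: "n > 0" and idem: "idempotent_on {1..n} f" and tr: "translatable n k f"
  obtains a b where "a \<in> {0..<n}" "b \<in> {0..<n}" "linear_op n a b f"
    "[a + b = 1] (mod n)" "[a + b * k = 0] (mod n)"
proof -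
  \<comment> \<open>Since \<open>rep n 0 = n\<close>, this is row \<open>n\<close> of the
    multiplication table, extended periodically to all integers.\<close>
  define g where "g u = f (rep n 0) (rep n u)" for u
  have g_cong: "g u = g v" if "[u = v] (mod n)" for u v
    using that n unfolding g_def by (metis rep_eq_iff)
  have g_rep: "g ((1 - k) * x) = rep n x" for x
  proof -
    \<comment> \<open>The integer \<open>x\<close> may be negative, so the diagonal entry is first
      moved to row \<open>n\<close> for \<open>rep n x\<close>, and then \<open>g_cong\<close>
      passes back to \<open>x\<close>.\<close>
    have pos: "rep n x \<ge> 0" and "f (rep n x) (rep n x) = rep n x"
      using idem rep_in[OF n, of x] by (auto simp: idempotent_on_def)
    moreover have "rep n (rep n x) = rep n x"
      using rep_id rep_in[OF n] by blast
    ultimately have "g (rep n x - k * rep n x) = rep n x"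
      using translatable_eq_diff[OF n tr pos, of "rep n x"] by (simp add: g_def)
    moreover have "[rep n x - k * rep n x = x - k * x] (mod n)"
      by (intro cong_diff cong_mult cong_refl rep_cong)
    ultimately have "g (x - k * x) = rep n x"
      using g_cong by metis
    then show ?thesis
      by (simp add: left_diff_distrib)
  qed
  \<comment> \<open>With \<open>d\<close> the gcd, multiplication by \<open>1 - k\<close> sends
    \<open>q = n / d\<close> to 0 modulo \<open>n\<close>. As \<open>g\<close> recovers
    \<open>x\<close> modulo \<open>n\<close> from \<open>(1 - k) * x\<close>, this forces
    \<open>n dvd q\<close>, hence \<open>d * q \<le> q\<close> and \<open>d = 1\<close>.\<close>
  have "coprime (1 - k) n"
  proof -
    define d where "d = gcd (1 - k) n"
    have d: "d > 0" "d dvd 1 - k" "d dvd n"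
      using n by (auto simp: d_def)
    obtain p q where p: "1 - k = d * p" and q: "n = d * q"
      using d by (auto elim!: dvdE)
    have "(1 - k) * q = n * p"
      using p q by simp
    then have "[(1 - k) * q = (1 - k) * 0] (mod n)"
      by (simp add: cong_def)
    from g_cong[OF this] have "rep n q = rep n 0"
      by (simp only: g_rep)
    then have "n dvd q"
      using n by (simp add: rep_eq_iff cong_0_iff)
    moreover have "q > 0"
      using n d(1) q by (simp add: zero_less_mult_iff)
    ultimately have "d * q \<le> 1 * q"
      using zdvd_imp_le[of n q] unfolding q by simp
    then have "d = 1"
      using \<open>q > 0\<close> d(1) by simp
    then show ?thesis
      unfolding d_def by (rule gcd_eq_1_imp_coprime)
  qed
  then obtain c where c: "[(1 - k) * c = 1] (mod n)"
    using cong_solve_coprime_int by blast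
  have g_eq: "g u = rep n (c * u)" for u
  proof -
    \<comment> \<open>This writes \<open>u\<close> as \<open>(1 - k) * (c * u)\<close> modulo
      \<open>n\<close>, a form at which \<open>g_rep\<close> gives the value of
      \<open>g\<close>.\<close>
    have "[(1 - k) * c * u = 1 * u] (mod n)"
      by (intro cong_mult c cong_refl)
    from g_cong[OF this] show ?thesis
      using g_rep[of "c * u"] by (simp add: mult.assoc)
  qed
  \<comment> \<open>These are the coefficients of \<open>c * (y - k * x)\<close>, reduced to the
    range {0..<n} in which the coefficients are sought.\<close>
  let ?a = "(- k * c) mod n" and ?b = "c mod n"
  have a: "[?a = - k * c] (mod n)" and b: "[?b = c] (mod n)"
    by (simp_all add: cong_def)
  have "linear_op n ?a ?b f"
    unfolding linear_op_def
  proof (intro ballI)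
    fix x y assume x: "x \<in> {1..n}" and y: "y \<in> {1..n}"
    have "f x y = g (y - k * x)"
      using translatable_eq_diff[OF n tr, of x y] x y by (simp add: rep_id g_def)
    also have "\<dots> = rep n (- k * c * x + c * y)"
      by (simp add: g_eq algebra_simps)
    also have "[?a * x + ?b * y = - k * c * x + c * y] (mod n)"
      by (intro cong_add cong_mult a b cong_refl)
    then have "rep n (- k * c * x + c * y) = rep n (?a * x + ?b * y)"
      using n by (metis rep_eq_iff)
    finally show "f x y = rep n (?a * x + ?b * y)" .
  qed
  moreover have "[?a + ?b = 1] (mod n)"
  proof -
    have "[?a + ?b = - k * c + c] (mod n)"
      by (intro cong_add a b)
    also have "- k * c + c = (1 - k) * c"
      by (simp add: algebra_simps)
    also note c
    finally show ?thesis .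
  qed
  moreover have "[?a + ?b * k = 0] (mod n)"
  proof -
    have "[?a + ?b * k = - k * c + c * k] (mod n)"
      by (intro cong_add cong_mult a b cong_refl)
    then show ?thesis
      by (simp add: mult.commute)
  qed
  ultimately show thesis
    using n by (intro that[of ?a ?b]) auto
qed

theorem theorem4p2:
  fixes n k :: int and f :: "int \<Rightarrow> int \<Rightarrow> int"
  assumes "n > 0" and "k > 0"
    and "groupoid_on {1..n} f"
  shows "(idempotent_on {1..n} f \<and> translatable n k f \<longleftrightarrow>
            (\<exists>a\<in>{0..<n}. \<exists>b\<in>{0..<n}. linear_op n a b f \<and>
               [a + b = 1] (mod n) \<and> [a + b * k = 0] (mod n)))
       \<and> (idempotent_on {1..n} f \<and> translatable n k f \<longleftrightarrow>
            (\<exists>a\<in>{0..<n}. \<exists>b\<in>{0..<n}. linear_op n a b f \<and>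
               f 1 1 = 1 \<and> f 1 (rep n k) = n))
       \<and> (\<forall>a\<in>{0..<n}. \<forall>b\<in>{0..<n}. linear_op n a b f \<longrightarrow>
            ([a + b = 1] (mod n) \<and> [a + b * k = 0] (mod n)
             \<longleftrightarrow> f 1 1 = 1 \<and> f 1 (rep n k) = n))"
proof -
  have "idempotent_on {1..n} f \<and> translatable n k f \<longleftrightarrow>
            (\<exists>a\<in>{0..<n}. \<exists>b\<in>{0..<n}. linear_op n a b f \<and>
               [a + b = 1] (mod n) \<and> [a + b * k = 0] (mod n))"
    (is "?L \<longleftrightarrow> ?R")
  proof
    assume ?L
    then show ?R
      using idempotent_translatable_linear[OF assms(1)] by metis
  next
    assume ?R
    then show ?L
      using linear_op_idempotent[OF assms(1)] linear_op_translatable[OF assms(1)] by blast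
  qed
  \<comment> \<open>The second equivalence follows from the first by exchanging the two conditions
    under the quantifiers; \<open>conj_cong\<close> makes \<open>linear_op n a b f\<close> available
    for that rewriting.\<close>
  then show ?thesis
    using linear_op_normal_form_iff[OF assms(1), of _ _ f k] by (simp cong: conj_cong)
qed

end
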